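(* Consider the structured boundary sampling algorithm described in the context, applied to one affine state constraint $H_i x + h_i \le 0$, under the cost model stated in the context. Let $n$ denote the state dimension, $m$ the input dimension, $K$ the number of time steps, $G = |\mathbb{G}|$ the number of grid samples, and $C = |C_i|$ the number of candidate points tested for admissibility. Then the algorithm has runtime complexity $$\mathcal{O}\left( n^3 + m^3 + Gn^2 + K(n^3 + m^3 + Gn^2) + CKGn \right).$$ In particular, the algorithm scales cubically in the state and input dimensions, and linearly in both the time horizon (number of time steps) and the number of grid samples. Furthermore, for $C \ll G$ and $G \gg n,m$, the complexity simplifies to $\mathcal{O}(KGn^2)$.
   Context: Setting: linear control system $\dot x(t) = A x(t) + B u(t)$, $A\in\mathbb{R}^{n\times n}$, $B\in\mathbb{R}^{n\times m}$, with $u(t)\in\mathbb{U}$, $\mathbb{U}\subset\mathbb{R}^m$ nonempty, convex and compact. For a step $\delta>0$, $A_d = e^{A\delta}$ and $B_d = \left(\int_0^\delta e^{A\tau}\,d\tau\right) B$. It is assumed that the matrix $\begin{pmatrix} H_i\\ H_iA\end{pmatrix}$ has kernel of dimension $n-2$. Algorithm. Inputs: $A$, $B$, $A_d$, $B_d$, $H_i\in\mathbb{R}^{1\times n}$, $h_i\in\mathbb{R}$, the set $\mathbb{U}$, a region of interest $\mathcal{X}_{\mathrm{ROI}}\subset\mathbb{R}^n$, a finite set $C_i$ of candidate points (corner points of $\mathcal{X}_{\mathrm{ROI}}$ and intersection points of $\mathcal{X}_{\mathrm{ROI}}$ with the constraint boundary), a number of time steps $K\in\mathbb{N}$, and a finite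 parameter grid $\mathbb{G}\subset\mathbb{R}^{n-2}$. Output: a finite sample set $\mathcal{S}_i$. 1. Set $\mathcal{S}_i\gets\emptyset$, $\mathcal{B}_i\gets\emptyset$, $M\gets\begin{pmatrix}H_i\\H_iA\end{pmatrix}$, $\lambda\gets H_i^\top$. 2. Compute $u^\ast=\mathrm{argmin}_{u\in\mathbb{U}} H_iBu$ and set $\mu\gets\begin{pmatrix}-h_i\\-H_iBu^\ast\end{pmatrix}$. 3. Compute one particular solution $\zeta_{\mathrm{ref}}$ of $M\zeta=\mu$ and an orthonormal basis $N\in\mathbb{R}^{n\times(n-2)}$ of $\ker M$. 4. For each $\alpha\in\mathbb{G}$: set $\zeta\gets\zeta_{\mathrm{ref}}+N\alpha$; if $\zeta\in\mathcal{X}_{\mathrm{ROI}}$ and $H_i\zeta+h_i\le0$, add $\zeta$ to $\mathcal{S}_i$ and $(\zeta,\lambda)$ to $\mathcal{B}_i$. 5. For $k=1,\dots,K$: (a) $\lambda\gets A_d^\top\lambda$; (b) compute $u^\ast=\mathrm{argmin}_{u\in\mathbb{U}}\lambda^\top Bu$; (c) $\zeta_{\mathrm{ref}}\gets A_d^{-1}(\zeta_{\mathrm{ref}}-B_du^\ast)$ and $N\gets\mathrm{orth}(A_d^{-1}N)$, where $\mathrm{orth}$ returns an orthonormal basis of the column span; (d) for each $\alpha\in\mathbb{G}$, perform the same step as in 4 with the current $\zeta_{\mathrm{ref}},N,\lambda$. 6. For every $x_c\in C_i$: if $\lambda_\zeta^\top(\zeta-x_c)\ge0$ for all $(\zeta,\lambda_\zeta)\in\mathcal{B}_i$,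 add $x_c$ to $\mathcal{S}_i$. 7. Return $\mathcal{S}_i$. Cost model (classical dense linear algebra, counting floating point operations): a dot product in $\mathbb{R}^n$ costs $\mathcal{O}(n)$; a dense matrix-vector product costs $\mathcal{O}(n^2)$; a dense matrix-matrix product costs $\mathcal{O}(n^3)$; solving the linear system in step 3 and computing the kernel basis cost $\mathcal{O}(n^3)$; the QR factorization (orthonormalization) of an $n\times(n-2)$ matrix costs $\mathcal{O}(n^3)$; each minimization of a linear functional over $\mathbb{U}$ (a linear program in $m$ variables) costs $\mathcal{O}(m^3)$; testing membership in $\mathcal{X}_{\mathrm{ROI}}$ (evaluation of linear inequalities) costs at most $\mathcal{O}(n^2)$.
   Formalization: The simplification to O(KGn^2) fails for C ≪ G and G ≫ n,m alone; it is proved when also C = O(n) and m^3 = O(Gn^2), or for bounded C with G large depending on n and m. At least one time step (K ≥ 1) is assumed. *)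

theory Defs
  imports
    "HOL-Library.State_Monad"
    "HOL-Library.Landau_Symbols"
    "HOL-Analysis.Function_Topology"
    "HOL-Analysis.Henstock_Kurzweil_Integration"
    "Jordan_Normal_Form.Matrix"
    "Jordan_Normal_Form.Matrix_Kernel"
begin

unbundle no vec_syntax

definition mat_exp :: "real mat \<Rightarrow> real mat" where
  "mat_exp X = mat (dim_row X) (dim_row X) (\<lambda>(i, j). \<Sum>k. (X ^\<^sub>m k) $$ (i, j) / fact k)"

definition mat_integral :: "real \<Rightarrow> real \<Rightarrow> nat \<Rightarrow> nat \<Rightarrow> (real \<Rightarrow> real mat) \<Rightarrow> real mat" where
  "mat_integral a b r c F = mat r c (\<lambda>(i, j). integral {a..b} (\<lambda>t. F t $$ (i, j)))"

definition column_span :: "real mat \<Rightarrow> real vec set" where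
  "column_span X = (\<lambda>v. X *\<^sub>v v) ` carrier_vec (dim_col X)"

definition orthonormal_basis_of :: "real mat \<Rightarrow> real vec set \<Rightarrow> bool" where
  "orthonormal_basis_of N V \<longleftrightarrow> transpose_mat N * N = 1\<^sub>m (dim_col N) \<and> column_span N = V"

definition convex_vecs :: "real vec set \<Rightarrow> bool" where
  "convex_vecs U \<longleftrightarrow>
     (\<forall>u\<in>U. \<forall>v\<in>U. \<forall>t. 0 \<le> t \<and> t \<le> 1 \<longrightarrow> t \<cdot>\<^sub>v u + (1 - t) \<cdot>\<^sub>v v \<in> U)"

text \<open>
  The type of vectors of unspecified dimension carries no topology. Padding with zeros embeds
  the vectors of dimension \<open>m\<close> homeomorphically into the product space of all real sequences.
\<close>
definition compact_vecs :: "nat \<Rightarrow> real vec set \<Rightarrow> bool" where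
  "compact_vecs m U \<longleftrightarrow> compact ((\<lambda>u i. if i < m then u $ i else 0) ` U)"

text \<open>Corner points are extreme points: not strictly between two distinct points of the set.\<close>
definition corner_points :: "real vec set \<Rightarrow> real vec set" where
  "corner_points X = {x \<in> X. \<forall>y\<in>X. \<forall>z\<in>X. \<forall>t.
     0 < t \<and> t < 1 \<and> x = t \<cdot>\<^sub>v y + (1 - t) \<cdot>\<^sub>v z \<longrightarrow> y = z}"

text \<open>
  The row vector \<open>H\<close> is stored as a vector. The finite sets of candidate points
  and of grid parameters are given by duplicate-free lists, so that their cardinality is the
  length and the loops over them have an order.
\<close>
record sampling_input =
  matA :: "real mat"
  matB :: "real mat"
  matAd :: "real mat"
  matBd :: "real mat"
  rowH :: "real vec"
  offh :: real
  ctrlU :: "real vec set"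
  roi :: "real vec set"
  cands :: "real vec list"
  steps :: nat
  grid :: "real vec list"

definition dim_n :: "sampling_input \<Rightarrow> nat" where "dim_n x = dim_row (matA x)"
definition dim_m :: "sampling_input \<Rightarrow> nat" where "dim_m x = dim_col (matB x)"
definition num_K :: "sampling_input \<Rightarrow> nat" where "num_K x = steps x"
definition num_G :: "sampling_input \<Rightarrow> nat" where "num_G x = card (set (grid x))"
definition num_C :: "sampling_input \<Rightarrow> nat" where "num_C x = card (set (cands x))"

definition stackM :: "nat \<Rightarrow> real vec \<Rightarrow> real vec \<Rightarrow> real mat" where
  "stackM n H HA = mat_of_rows n [H, HA]"

definition valid_input :: "sampling_input \<Rightarrow> bool" where
  "valid_input x \<longleftrightarrow> (let n = dim_n x; m = dim_m x in
     2 \<le> n \<and> 1 \<le> m \<and> 1 \<le> num_K x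
   \<and> matA x \<in> carrier_mat n n \<and> matB x \<in> carrier_mat n m \<and> rowH x \<in> carrier_vec n
   \<and> ctrlU x \<subseteq> carrier_vec m \<and> ctrlU x \<noteq> {} \<and> convex_vecs (ctrlU x) \<and> compact_vecs m (ctrlU x)
   \<and> (\<exists>\<delta>>0. matAd x = mat_exp (\<delta> \<cdot>\<^sub>m matA x)
          \<and> matBd x = mat_integral 0 \<delta> n n (\<lambda>\<tau>. mat_exp (\<tau> \<cdot>\<^sub>m matA x)) * matB x)
   \<and> kernel_dim (stackM n (rowH x) (transpose_mat (matA x) *\<^sub>v rowH x)) = n - 2
   \<and> roi x \<subseteq> carrier_vec n
   \<and> distinct (cands x)
   \<and> set (cands x) \<subseteq> corner_points (roi x) \<union> {z \<in> roi x. rowH x \<bullet> z + offh x = 0}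
   \<and> distinct (grid x) \<and> set (grid x) \<subseteq> carrier_vec (n - 2))"

text \<open>
  The algorithm leaves open which minimizer, which particular solution and which orthonormal
  basis is used. An implementation makes these choices.
\<close>
record kernels =
  lin_min :: "real vec set \<Rightarrow> real vec \<Rightarrow> real vec"
  solve :: "real mat \<Rightarrow> real vec \<Rightarrow> real vec"
  null_basis :: "real mat \<Rightarrow> real mat"
  orth :: "real mat \<Rightarrow> real mat"
  invert :: "real mat \<Rightarrow> real mat"

definition correct_kernels :: "kernels \<Rightarrow> bool" where
  "correct_kernels ks \<longleftrightarrow>
     (\<forall>m U c. U \<subseteq> carrier_vec m \<and> U \<noteq> {} \<and> compact_vecs m U \<and> c \<in> carrier_vec m \<longrightarrow>
        is_arg_min (\<lambda>u. c \<bullet> u) (\<lambda>u. u \<in> U) (lin_min ks U c))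
   \<and> (\<forall>M y. solve ks M y \<in> carrier_vec (dim_col M)
        \<and> ((\<exists>z\<in>carrier_vec (dim_col M). M *\<^sub>v z = y) \<longrightarrow> M *\<^sub>v solve ks M y = y))
   \<and> (\<forall>M. dim_row (null_basis ks M) = dim_col M
        \<and> orthonormal_basis_of (null_basis ks M) (mat_kernel M))
   \<and> (\<forall>X. dim_row (orth ks X) = dim_row X
        \<and> orthonormal_basis_of (orth ks X) (column_span X))
   \<and> (\<forall>n. \<forall>X\<in>carrier_mat n n. invert ks X \<in> carrier_mat n n
        \<and> (invertible_mat X \<longrightarrow> inverts_mat X (invert ks X) \<and> inverts_mat (invert ks X) X))"

text \<open>
  Operation counts as functions of the operand dimensions (rows, then columns, for a matrix;
  the three dimensions of \<open>t_matmul\<close> are those of a product of an \<open>r \<times> s\<close> and an \<open>s \<times> c\<close> matrix).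
\<close>
record cost_model =
  t_dot :: "nat \<Rightarrow> nat"
  t_matvec :: "nat \<Rightarrow> nat \<Rightarrow> nat"
  t_matmul :: "nat \<Rightarrow> nat \<Rightarrow> nat \<Rightarrow> nat"
  t_solve :: "nat \<Rightarrow> nat \<Rightarrow> nat"
  t_null :: "nat \<Rightarrow> nat \<Rightarrow> nat"
  t_orth :: "nat \<Rightarrow> nat \<Rightarrow> nat"
  t_inv :: "nat \<Rightarrow> nat"
  t_lp :: "nat \<Rightarrow> nat"
  t_roi :: "nat \<Rightarrow> nat"

text \<open>
  Over a principal filter, \<open>O\<close> is a bound with one constant for all dimensions, not only for
  large ones. An operation on rectangular operands is only required to be as cheap as on square
  operands of the largest dimension involved, which is weaker than the usual bounds by the
  product of the dimensions.
\<close>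
definition dense_cost_model :: "cost_model \<Rightarrow> bool" where
  "dense_cost_model cm \<longleftrightarrow>
     (\<lambda>n. real (t_dot cm n)) \<in> O[principal {1..}](\<lambda>n. real n)
   \<and> (\<lambda>(r, c). real (t_matvec cm r c)) \<in> O[principal ({1..} \<times> UNIV)](\<lambda>(r, c). real (max r c) ^ 2)
   \<and> (\<lambda>(r, s, c). real (t_matmul cm r s c))
        \<in> O[principal ({1..} \<times> UNIV)](\<lambda>(r, s, c). real (max r (max s c)) ^ 3)
   \<and> (\<lambda>(r, c). real (t_solve cm r c)) \<in> O[principal ({1..} \<times> UNIV)](\<lambda>(r, c). real (max r c) ^ 3)
   \<and> (\<lambda>(r, c). real (t_null cm r c)) \<in> O[principal ({1..} \<times> UNIV)](\<lambda>(r, c). real (max r c) ^ 3)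
   \<and> (\<lambda>(r, c). real (t_orth cm r c)) \<in> O[principal ({1..} \<times> UNIV)](\<lambda>(r, c). real (max r c) ^ 3)
   \<and> (\<lambda>n. real (t_inv cm n)) \<in> O[principal {1..}](\<lambda>n. real n ^ 3)
   \<and> (\<lambda>m. real (t_lp cm m)) \<in> O[principal {1..}](\<lambda>m. real m ^ 3)
   \<and> (\<lambda>n. real (t_roi cm n)) \<in> O[principal {1..}](\<lambda>n. real n ^ 2)"

text \<open>
  The state is the operation counter. Real arithmetic is exact; scalar operations and
  comparisons cost one operation each, sums and differences of vectors one per component.
  Transposing, copying and inserting into the result sets involve no arithmetic. The inverse of \<open>matAd\<close> is not taken as
  given but computed anew, and charged, in every time step; and no conjunction is evaluated
  lazily, so that every count below is the worst case.
\<close>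
type_synonym 'a counted = "(nat, 'a) state"

abbreviation return :: "'a \<Rightarrow> 'a counted" where
  "return \<equiv> State_Monad.return"

definition charge :: "nat \<Rightarrow> 'a \<Rightarrow> 'a counted" where
  "charge c a = State (\<lambda>t. (a, t + c))"

primrec foldC :: "('a \<Rightarrow> 'b \<Rightarrow> 'b counted) \<Rightarrow> 'a list \<Rightarrow> 'b \<Rightarrow> 'b counted" where
  "foldC f [] s = return s"
| "foldC f (a # as) s = do { s' \<leftarrow> f a s; foldC f as s' }"

definition addC :: "real \<Rightarrow> real \<Rightarrow> real counted" where
  "addC a b = charge 1 (a + b)"

definition negC :: "real \<Rightarrow> real counted" where
  "negC a = charge 1 (- a)"

definition leC :: "real \<Rightarrow> real \<Rightarrow> bool counted" where
  "leC a b = charge 1 (a \<le> b)"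

definition vaddC :: "real vec \<Rightarrow> real vec \<Rightarrow> real vec counted" where
  "vaddC v w = charge (dim_vec (v + w)) (v + w)"

definition vsubC :: "real vec \<Rightarrow> real vec \<Rightarrow> real vec counted" where
  "vsubC v w = charge (dim_vec (v - w)) (v - w)"

definition dotC :: "cost_model \<Rightarrow> real vec \<Rightarrow> real vec \<Rightarrow> real counted" where
  "dotC cm v w = charge (t_dot cm (dim_vec v)) (v \<bullet> w)"

definition matvecC :: "cost_model \<Rightarrow> real mat \<Rightarrow> real vec \<Rightarrow> real vec counted" where
  "matvecC cm X v = charge (t_matvec cm (dim_row X) (dim_col X)) (X *\<^sub>v v)"

definition matmulC :: "cost_model \<Rightarrow> real mat \<Rightarrow> real mat \<Rightarrow> real mat counted" where
  "matmulC cm X Y = charge (t_matmul cm (dim_row X) (dim_col X) (dim_col Y)) (X * Y)"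

definition solveC :: "kernels \<Rightarrow> cost_model \<Rightarrow> real mat \<Rightarrow> real vec \<Rightarrow> real vec counted" where
  "solveC ks cm M y = charge (t_solve cm (dim_row M) (dim_col M)) (solve ks M y)"

definition nullC :: "kernels \<Rightarrow> cost_model \<Rightarrow> real mat \<Rightarrow> real mat counted" where
  "nullC ks cm M = charge (t_null cm (dim_row M) (dim_col M)) (null_basis ks M)"

definition orthC :: "kernels \<Rightarrow> cost_model \<Rightarrow> real mat \<Rightarrow> real mat counted" where
  "orthC ks cm X = charge (t_orth cm (dim_row X) (dim_col X)) (orth ks X)"

definition invC :: "kernels \<Rightarrow> cost_model \<Rightarrow> real mat \<Rightarrow> real mat counted" where
  "invC ks cm X = charge (t_inv cm (dim_row X)) (invert ks X)"

definition argminC :: "kernels \<Rightarrow> cost_model \<Rightarrow> real vec set \<Rightarrow> real vec \<Rightarrow> real vec counted" where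
  "argminC ks cm U c = charge (t_lp cm (dim_vec c)) (lin_min ks U c)"

definition roiC :: "cost_model \<Rightarrow> real vec set \<Rightarrow> real vec \<Rightarrow> bool counted" where
  "roiC cm X z = charge (t_roi cm (dim_vec z)) (z \<in> X)"

type_synonym samples = "real vec set \<times> (real vec \<times> real vec) list"

definition sample_grid ::
  "cost_model \<Rightarrow> sampling_input \<Rightarrow> real vec \<Rightarrow> real mat \<Rightarrow> real vec \<Rightarrow> samples \<Rightarrow> samples counted"
where
  "sample_grid cm x \<zeta>ref N lam = foldC (\<lambda>\<alpha> (S, Bs). do {
     w \<leftarrow> matvecC cm N \<alpha>;
     \<zeta> \<leftarrow> vaddC \<zeta>ref w;
     inside \<leftarrow> roiC cm (roi x) \<zeta>;
     g \<leftarrow> dotC cm (rowH x) \<zeta>;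
     g' \<leftarrow> addC g (offh x);
     feasible \<leftarrow> leC g' 0;
     return (if inside \<and> feasible then (insert \<zeta> S, List.insert (\<zeta>, lam) Bs) else (S, Bs))
   }) (grid x)"

definition time_step ::
  "kernels \<Rightarrow> cost_model \<Rightarrow> sampling_input \<Rightarrow> real vec \<times> real vec \<times> real mat \<times> samples
     \<Rightarrow> (real vec \<times> real vec \<times> real mat \<times> samples) counted"
where
  "time_step ks cm x = (\<lambda>(lam, \<zeta>ref, N, out). do {
     lam' \<leftarrow> matvecC cm (transpose_mat (matAd x)) lam;
     c \<leftarrow> matvecC cm (transpose_mat (matB x)) lam';
     u \<leftarrow> argminC ks cm (ctrlU x) c;
     w \<leftarrow> matvecC cm (matBd x) u;
     d \<leftarrow> vsubC \<zeta>ref w;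
     Ai \<leftarrow> invC ks cm (matAd x);
     \<zeta>new \<leftarrow> matvecC cm Ai d;
     X \<leftarrow> matmulC cm Ai N;
     N' \<leftarrow> orthC ks cm X;
     out' \<leftarrow> sample_grid cm x \<zeta>new N' lam' out;
     return (lam', \<zeta>new, N', out')
   })"

definition admissible ::
  "cost_model \<Rightarrow> (real vec \<times> real vec) list \<Rightarrow> real vec \<Rightarrow> bool counted"
where
  "admissible cm Bs xc = foldC (\<lambda>(\<zeta>, lz) ok. do {
     d \<leftarrow> vsubC \<zeta> xc;
     p \<leftarrow> dotC cm lz d;
     nonneg \<leftarrow> leC 0 p;
     return (ok \<and> nonneg)
   }) Bs True"

definition boundary_sampling ::
  "kernels \<Rightarrow> cost_model \<Rightarrow> sampling_input \<Rightarrow> real vec set counted"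
where
  "boundary_sampling ks cm x = do {
     HA \<leftarrow> matvecC cm (transpose_mat (matA x)) (rowH x);
     let M = stackM (dim_n x) (rowH x) HA;
     c \<leftarrow> matvecC cm (transpose_mat (matB x)) (rowH x);
     u \<leftarrow> argminC ks cm (ctrlU x) c;
     v \<leftarrow> dotC cm c u;
     mu1 \<leftarrow> negC (offh x);
     mu2 \<leftarrow> negC v;
     \<zeta>ref \<leftarrow> solveC ks cm M (vec_of_list [mu1, mu2]);
     N \<leftarrow> nullC ks cm M;
     out \<leftarrow> sample_grid cm x \<zeta>ref N (rowH x) ({}, []);
     (_, _, _, S, Bs) \<leftarrow> foldC (\<lambda>_. time_step ks cm x) [1..<Suc (steps x)] (rowH x, \<zeta>ref, N, out);
     foldC (\<lambda>xc S. do {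
       ok \<leftarrow> admissible cm Bs xc;
       return (if ok then insert xc S else S)
     }) (cands x) S
   }"

definition runtime :: "kernels \<Rightarrow> cost_model \<Rightarrow> sampling_input \<Rightarrow> real" where
  "runtime ks cm x = real (snd (run_state (boundary_sampling ks cm x) 0))"

end

theory Submission
  imports Defs
begin

text \<open>
  A run consists of one initialisation, \<open>K\<close> time steps and \<open>C\<close> admissibility tests.
  Its cost depends on the data only through the operand dimensions and the number of recorded samples, so each
  part can be bounded by adding up the charges of its instructions. An initialisation or a time step performs
  a fixed number of dense operations, whose operands have dimensions at most \<open>n\<close> or
  \<open>m\<close>, and one pass over the grid, which costs \<open>O(n^2)\<close> per grid point; together
  \<open>O(n^3 + m^3 + G n^2)\<close>. An admissibility test computes one inner product, \<open>O(n)\<close>,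
  for each recorded boundary sample.

  Three observations turn this into a proof. First, the constants implicit in the cost model are uniform in
  the dimensions, so one constant \<open>c\<close> serves every operation
  (\<open>dense_cost_model_imp_dense_costs\<close>). Secondly, the number of columns of the computed bases is
  not prescribed directly, but columns in \<open>\<real>^n\<close> that are orthonormal number at most
  \<open>n\<close> (\<open>orthonormal_basis_dim_col_le\<close>), so the operands do not grow from step to
  step. Thirdly, every grid pass records at most \<open>G\<close> samples, and there are \<open>K + 1 \<le> 2
  K\<close> passes, so that the \<open>C\<close> tests cost \<open>O(C K G n)\<close> altogether. The last two
  facts are loop invariants, and the costs are added up in a Hoare logic for counted programs
  (\<open>runs_within\<close>). The outcome, \<open>runtime_le\<close>, is an inequality with an explicit
  constant which holds for each valid input.

  The remaining claims are arithmetic consequences of that inequality. For the linear and cubic scaling each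
  summand is bounded by a multiple of the one varying quantity, which is at least one. For the simplified
  bounds, \<open>G\<close> is large enough that \<open>n \<le> G\<close> or even \<open>n^3 + m^3 \<le>
  G\<close>; this gives \<open>n^3 \<le> G n^2\<close>, while \<open>m^3\<close> is at most a multiple of
  \<open>G n^2\<close>, and \<open>C\<close> being at most a multiple of \<open>n\<close> absorbs \<open>C K G
  n\<close> into \<open>K G n^2\<close>.
\<close>

section \<open>Matrices with orthonormal columns\<close>

text \<open>
  If \<open>n < k\<close>, zero columns can be added to \<open>A\<close> and zero rows to \<open>B\<close> without changing their
  product. Both factors are then square, but the first one has a zero column and is singular,
  whereas the identity is not.
\<close>
lemma left_inverse_dim_le:
  fixes A B :: "'a::field mat"
  assumes A: "A \<in> carrier_mat k n" and B: "B \<in> carrier_mat n k" and AB: "A * B = 1\<^sub>m k"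
  shows "k \<le> n"
proof (rule ccontr)
  assume "\<not> k \<le> n"
  then have nk: "n < k" by simp
  define A' where "A' = mat k k (\<lambda>(i, j). if j < n then A $$ (i, j) else 0)"
  define B' where "B' = mat k k (\<lambda>(i, j). if i < n then B $$ (i, j) else 0)"
  have A': "A' \<in> carrier_mat k k" and B': "B' \<in> carrier_mat k k"
    by (simp_all add: A'_def B'_def)
  have "A' * B' = A * B"
  proof (rule eq_matI)
    fix i j assume "i < dim_row (A * B)" and "j < dim_col (A * B)"
    then have ij: "i < k" "j < k" using A B by auto
    have "(A' * B') $$ (i, j) = (\<Sum>l<k. A' $$ (i, l) * B' $$ (l, j))"
      using ij A' B' by (simp add: scalar_prod_def lessThan_atLeast0)
    also have "\<dots> = (\<Sum>l<n. A $$ (i, l) * B $$ (l, j))"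
      using ij nk by (intro sum.mono_neutral_cong_right) (auto simp: A'_def B'_def)
    also have "\<dots> = (A * B) $$ (i, j)"
      using ij A B by (simp add: scalar_prod_def lessThan_atLeast0)
    finally show "(A' * B') $$ (i, j) = (A * B) $$ (i, j)" .
  qed (use A A' B B' in auto)
  then have "det A' * det B' = 1"
    using det_mult[OF A' B'] AB by simp
  moreover have "A' *\<^sub>v unit_vec k n = 0\<^sub>v k"
    using nk by (intro eq_vecI) (auto simp: A'_def)
  then have "det A' = 0"
    using nk by (subst det_0_iff_vec_prod_zero_field[OF A']) (auto intro!: exI[of _ "unit_vec k n"])
  ultimately show False by simp
qed

lemma orthonormal_basis_dim_col_le:
  assumes "orthonormal_basis_of N V"
  shows "dim_col N \<le> dim_row N"
proof (rule left_inverse_dim_le)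
  show "transpose_mat N * N = 1\<^sub>m (dim_col N)"
    using assms by (simp only: orthonormal_basis_of_def)
qed (rule carrier_matI; simp)+

section \<open>A Hoare logic for counted programs\<close>

definition runs_within :: "'a counted \<Rightarrow> nat \<Rightarrow> ('a \<Rightarrow> bool) \<Rightarrow> bool" where
  "runs_within p c Q \<longleftrightarrow> (\<forall>t. snd (run_state p t) \<le> t + c \<and> Q (fst (run_state p t)))"

lemma runs_within_return: "Q a \<Longrightarrow> runs_within (return a) 0 Q"
  by (simp add: runs_within_def)

lemma runs_within_charge: "Q a \<Longrightarrow> runs_within (charge c a) c Q"
  by (simp add: runs_within_def charge_def)

lemma runs_within_bind:
  assumes "runs_within p c P" and "\<And>a. P a \<Longrightarrow> runs_within (f a) d Q"
  shows "runs_within (State_Monad.bind p f) (c + d) Q"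
  unfolding runs_within_def
proof
  fix t
  obtain a s where r: "run_state p t = (a, s)" by fastforce
  with assms(1) have "s \<le> t + c" and "P a" by (metis runs_within_def fst_conv snd_conv)+
  moreover from assms(2)[OF \<open>P a\<close>]
  have "snd (run_state (f a) s) \<le> s + d" and "Q (fst (run_state (f a) s))"
    by (simp_all add: runs_within_def)
  ultimately show "snd (run_state (State_Monad.bind p f) t) \<le> t + (c + d)
      \<and> Q (fst (run_state (State_Monad.bind p f) t))"
    using r by simp
qed

text \<open>
  For the basic operations the result is kept as a term instead of being abstracted to a
  postcondition, so that its dimensions stay available to the charges that follow.
\<close>
lemma runs_within_charge_bind:
  "runs_within (f a) d Q \<Longrightarrow> runs_within (State_Monad.bind (charge c a) f) (c + d) Q"
  by (rule runs_within_bind[OF runs_within_charge[where Q = "\<lambda>b. b = a"]]) auto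

lemma runs_within_weaken: "runs_within p c Q \<Longrightarrow> c \<le> d \<Longrightarrow> runs_within p d Q"
  unfolding runs_within_def by (meson add_left_mono order_trans)

text \<open>
  The invariant is indexed by the number of iterations because the quantity to be controlled,
  the length of the list of records, grows with them.
\<close>
lemma runs_within_foldC:
  assumes "\<And>a k s. a \<in> set as \<Longrightarrow> I k s \<Longrightarrow> runs_within (f a s) c (I (Suc k))" and "I k s"
  shows "runs_within (foldC f as s) (length as * c) (I (k + length as))"
  using assms
proof (induction as arbitrary: k s)
  case Nil
  then show ?case by (simp add: runs_within_return)
next
  case (Cons a as)
  have first: "runs_within (f a s) c (I (Suc k))"
    by (rule Cons.prems(1)[OF _ Cons.prems(2)]) simp
  have rest: "runs_within (foldC f as s') (length as * c) (I (k + length (a # as)))"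
    if "I (Suc k) s'" for s'
    using Cons.IH[OF Cons.prems(1) that] by simp
  have "runs_within (State_Monad.bind (f a s) (foldC f as)) (c + length as * c)
      (I (k + length (a # as)))"
    by (rule runs_within_bind[OF first]) (rule rest)
  then show ?case by simp
qed

section \<open>One constant for all operation costs\<close>

locale dense_costs =
  fixes cm :: cost_model and c :: nat
  assumes c_pos: "1 \<le> c"
    and dot_le: "\<And>n. 1 \<le> n \<Longrightarrow> t_dot cm n \<le> c * n"
    and matvec_le: "\<And>r s. 1 \<le> r \<Longrightarrow> t_matvec cm r s \<le> c * max r s ^ 2"
    and matmul_le: "\<And>r s q. 1 \<le> r \<Longrightarrow> t_matmul cm r s q \<le> c * max r (max s q) ^ 3"
    and solve_le: "\<And>r s. 1 \<le> r \<Longrightarrow> t_solve cm r s \<le> c * max r s ^ 3"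
    and null_le: "\<And>r s. 1 \<le> r \<Longrightarrow> t_null cm r s \<le> c * max r s ^ 3"
    and orth_le: "\<And>r s. 1 \<le> r \<Longrightarrow> t_orth cm r s \<le> c * max r s ^ 3"
    and inv_le: "\<And>n. 1 \<le> n \<Longrightarrow> t_inv cm n \<le> c * n ^ 3"
    and lp_le: "\<And>m. 1 \<le> m \<Longrightarrow> t_lp cm m \<le> c * m ^ 3"
    and roi_le: "\<And>n. 1 \<le> n \<Longrightarrow> t_roi cm n \<le> c * n ^ 2"

text \<open>
  Over a principal filter, every sufficiently large natural number is a valid constant. Stating
  this as an eventuality allows constants for several operations to be merged without computing
  their maximum.
\<close>
lemma eventually_constant_for_bigo:
  fixes f g :: "'a \<Rightarrow> nat"
  assumes "(\<lambda>x. real (f x)) \<in> O[principal S](\<lambda>x. real (g x))"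
  shows "\<forall>\<^sub>F d in sequentially. \<forall>x\<in>S. f x \<le> d * g x"
proof -
  obtain b where b: "\<And>x. x \<in> S \<Longrightarrow> real (f x) \<le> b * real (g x)"
    using assms by (auto simp: bigo_def eventually_principal)
  have "f x \<le> d * g x" if "nat \<lceil>b\<rceil> \<le> d" "x \<in> S" for d x
  proof -
    have "b \<le> real d" using that(1) by linarith
    then have "real (f x) \<le> real d * real (g x)"
      using b[OF that(2)] by (meson mult_right_mono of_nat_0_le_iff order_trans)
    then show ?thesis by (metis of_nat_mult of_nat_le_iff)
  qed
  then show ?thesis unfolding eventually_sequentially by blast
qed

lemma dense_cost_model_imp_dense_costs:
  assumes "dense_cost_model cm"
  shows "\<exists>c. dense_costs cm c"
proof -
  let ?P = "{1::nat..} \<times> (UNIV :: nat set)" and ?T = "{1::nat..} \<times> (UNIV :: (nat \<times> nat) set)"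
  have "\<forall>\<^sub>F d in sequentially. 1 \<le> d
      \<and> (\<forall>n\<in>{1..}. t_dot cm n \<le> d * n)
      \<and> (\<forall>p\<in>?P. t_matvec cm (fst p) (snd p) \<le> d * max (fst p) (snd p) ^ 2)
      \<and> (\<forall>p\<in>?T. t_matmul cm (fst p) (fst (snd p)) (snd (snd p))
            \<le> d * max (fst p) (max (fst (snd p)) (snd (snd p))) ^ 3)
      \<and> (\<forall>p\<in>?P. t_solve cm (fst p) (snd p) \<le> d * max (fst p) (snd p) ^ 3)
      \<and> (\<forall>p\<in>?P. t_null cm (fst p) (snd p) \<le> d * max (fst p) (snd p) ^ 3)
      \<and> (\<forall>p\<in>?P. t_orth cm (fst p) (snd p) \<le> d * max (fst p) (snd p) ^ 3)
      \<and> (\<forall>n\<in>{1..}. t_inv cm n \<le> d * n ^ 3)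
      \<and> (\<forall>m\<in>{1..}. t_lp cm m \<le> d * m ^ 3)
      \<and> (\<forall>n\<in>{1..}. t_roi cm n \<le> d * n ^ 2)"
    using assms unfolding dense_cost_model_def
    by (intro eventually_conj eventually_ge_at_top eventually_constant_for_bigo)
      (simp_all add: case_prod_unfold)
  then obtain d where "1 \<le> d"
      "\<forall>n\<in>{1..}. t_dot cm n \<le> d * n"
      "\<forall>p\<in>?P. t_matvec cm (fst p) (snd p) \<le> d * max (fst p) (snd p) ^ 2"
      "\<forall>p\<in>?T. t_matmul cm (fst p) (fst (snd p)) (snd (snd p))
            \<le> d * max (fst p) (max (fst (snd p)) (snd (snd p))) ^ 3"
      "\<forall>p\<in>?P. t_solve cm (fst p) (snd p) \<le> d * max (fst p) (snd p) ^ 3"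
      "\<forall>p\<in>?P. t_null cm (fst p) (snd p) \<le> d * max (fst p) (snd p) ^ 3"
      "\<forall>p\<in>?P. t_orth cm (fst p) (snd p) \<le> d * max (fst p) (snd p) ^ 3"
      "\<forall>n\<in>{1..}. t_inv cm n \<le> d * n ^ 3"
      "\<forall>m\<in>{1..}. t_lp cm m \<le> d * m ^ 3"
      "\<forall>n\<in>{1..}. t_roi cm n \<le> d * n ^ 2"
    using eventually_happens'[OF sequentially_bot] by blast
  then have "dense_costs cm d" by unfold_locales auto
  then show ?thesis ..
qed

section \<open>Cost of the parts of a run\<close>

locale sampling_run = dense_costs +
  fixes ks :: kernels and x :: sampling_input
  assumes kernels: "correct_kernels ks" and valid: "valid_input x"
begin

abbreviation "n \<equiv> dim_n x"
abbreviation "m \<equiv> dim_m x"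
abbreviation "K \<equiv> num_K x"
abbreviation "G \<equiv> num_G x"
abbreviation "C \<equiv> num_C x"

definition step_work :: nat where
  "step_work = n ^ 3 + m ^ 3 + G * n ^ 2"

text \<open>
  The dimensions of the stored multipliers are part of the invariant because the inner products
  of the admissibility tests are charged by them.
\<close>
definition recorded_at_most :: "nat \<Rightarrow> samples \<Rightarrow> bool" where
  "recorded_at_most b = (\<lambda>(S, Bs). length Bs \<le> b \<and> (\<forall>(\<zeta>, l)\<in>set Bs. dim_vec l = n))"

lemma sizes: "2 \<le> n" "1 \<le> m" "1 \<le> K"
  using valid unfolding valid_input_def Let_def by blast+

lemma dims:
  shows "dim_row (matA x) = n" "dim_col (matA x) = n" "dim_row (matB x) = n" "dim_col (matB x) = m"
    and "dim_row (matAd x) = n" "dim_col (matAd x) = n" "dim_row (matBd x) = n" "dim_col (matBd x) = m"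
    and "dim_vec (rowH x) = n"
proof -
  note v = valid[unfolded valid_input_def Let_def]
  have "matA x \<in> carrier_mat n n" "matB x \<in> carrier_mat n m" "rowH x \<in> carrier_vec n"
    using v by blast+
  then show AB: "dim_row (matA x) = n" "dim_col (matA x) = n" "dim_row (matB x) = n"
      "dim_col (matB x) = m" "dim_vec (rowH x) = n"
    by (metis carrier_matD carrier_vecD)+
  obtain \<delta> where Ad: "matAd x = mat_exp (\<delta> \<cdot>\<^sub>m matA x)"
    and Bd: "matBd x = mat_integral 0 \<delta> n n (\<lambda>\<tau>. mat_exp (\<tau> \<cdot>\<^sub>m matA x)) * matB x"
    using v by blast
  show "dim_row (matAd x) = n" "dim_col (matAd x) = n"
    unfolding Ad mat_exp_def by (simp_all add: AB)
  show "dim_row (matBd x) = n" "dim_col (matBd x) = m"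
    unfolding Bd mat_integral_def by (simp_all add: AB)
qed

lemma num_eq_length: "length (grid x) = G" "length (cands x) = C" "steps x = K"
proof -
  have "distinct (grid x)" "distinct (cands x)"
    using valid unfolding valid_input_def Let_def by blast+
  then show "length (grid x) = G" "length (cands x) = C" "steps x = K"
    by (simp_all add: num_G_def num_C_def num_K_def distinct_card)
qed

lemma cand_dim:
  assumes "xc \<in> set (cands x)"
  shows "dim_vec xc = n"
proof -
  note assms
  moreover have "set (cands x) \<subseteq> corner_points (roi x) \<union> {z \<in> roi x. rowH x \<bullet> z + offh x = 0}"
    and roi: "roi x \<subseteq> carrier_vec n"
    using valid unfolding valid_input_def Let_def by blast+
  ultimately have "xc \<in> roi x" unfolding corner_points_def by blast
  with roi show ?thesis by auto
qed

lemma dim_invert: "dim_row (invert ks (matAd x)) = n" "dim_col (invert ks (matAd x)) = n"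
proof -
  have "invert ks (matAd x) \<in> carrier_mat n n"
    using kernels dims unfolding correct_kernels_def by blast
  then show "dim_row (invert ks (matAd x)) = n" "dim_col (invert ks (matAd x)) = n" by auto
qed

lemma dim_null_basis:
  "dim_row (null_basis ks M) = dim_col M" "dim_col (null_basis ks M) \<le> dim_col M"
  using kernels orthonormal_basis_dim_col_le unfolding correct_kernels_def by metis+

lemma dim_orth: "dim_row (orth ks X) = dim_row X" "dim_col (orth ks X) \<le> dim_row X"
  using kernels orthonormal_basis_dim_col_le unfolding correct_kernels_def by metis+

text \<open>
  Lower-order terms are absorbed by \<open>n^3 + m^3\<close>. The mixed products with \<open>matB\<close> and \<open>matBd\<close>
  are charged by the larger of the two dimensions, hence the last estimate.
\<close>
lemma powers:
  "n \<le> n ^ 2" "2 \<le> n ^ 2" "n \<le> n ^ 3" "n ^ 2 \<le> n ^ 3" "2 \<le> n ^ 3" "m \<le> m ^ 3" "m ^ 2 \<le> m ^ 3"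
  "n ^ 2 \<le> n ^ 3 + m ^ 3" "max n m ^ 2 \<le> n ^ 3 + m ^ 3"
proof -
  show n: "n \<le> n ^ 2" "n \<le> n ^ 3" "n ^ 2 \<le> n ^ 3" and m: "m \<le> m ^ 3" "m ^ 2 \<le> m ^ 3"
    using sizes by (auto intro: power_increasing simp: self_le_power)
  show "2 \<le> n ^ 2" "2 \<le> n ^ 3" "n ^ 2 \<le> n ^ 3 + m ^ 3"
    using n sizes by linarith+
  show "max n m ^ 2 \<le> n ^ 3 + m ^ 3"
    using n(3) m(2) by (cases "n \<le> m") (simp_all add: max_absorb1 max_absorb2)
qed

lemma cost_mono: "t \<le> c * a \<Longrightarrow> a \<le> b \<Longrightarrow> t \<le> c * b" for t a b :: nat
  by (meson le_trans mult_le_mono2)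

lemma le_cost: "a \<le> b \<Longrightarrow> a \<le> c * b" for a b :: nat
  using c_pos by (metis le_trans mult_le_mono mult_1)

text \<open>
  At each grid point the product \<open>N \<alpha>\<close> and the membership test dominate. There are
  four charges of at most \<open>c n^2\<close> each, and the two scalar operations fit into a fifth, which the
  constant 6 covers generously.
\<close>
lemma sample_grid_within:
  assumes "dim_row N = n" "dim_col N \<le> n" "dim_vec lam = n" "recorded_at_most b out"
  shows "runs_within (sample_grid cm x \<zeta>ref N lam out) (G * (6 * c * n ^ 2)) (recorded_at_most (b + G))"
proof -
  let ?point = "\<lambda>\<alpha> (S, Bs). do {
       w \<leftarrow> matvecC cm N \<alpha>;
       \<zeta> \<leftarrow> vaddC \<zeta>ref w;
       inside \<leftarrow> roiC cm (roi x) \<zeta>;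
       g \<leftarrow> dotC cm (rowH x) \<zeta>;
       g' \<leftarrow> addC g (offh x);
       feasible \<leftarrow> leC g' 0;
       return (if inside \<and> feasible then (insert \<zeta> S, List.insert (\<zeta>, lam) Bs) else (S, Bs))
     }"
  have point: "runs_within (?point \<alpha> out) (6 * c * n ^ 2) (recorded_at_most (Suc b))"
    if "recorded_at_most b out" for \<alpha> b out
  proof -
    obtain S Bs where [simp]: "out = (S, Bs)" by fastforce
    have a: "t_matvec cm n (dim_col N) \<le> c * n ^ 2"
      using matvec_le[of n "dim_col N"] sizes assms by (simp add: max_absorb1)
    have b: "n \<le> c * n ^ 2" "2 \<le> c * n ^ 2"
      using powers by (auto intro: le_cost)
    have d: "t_dot cm n \<le> c * n ^ 2" "t_roi cm n \<le> c * n ^ 2"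
      using dot_le[of n] roi_le[of n] sizes powers by (auto intro: cost_mono)
    show ?thesis
      unfolding matvecC_def vaddC_def roiC_def dotC_def addC_def leC_def \<open>out = _\<close> prod.case
      apply (rule runs_within_weaken)
       apply (rule runs_within_charge_bind)+
       apply (rule runs_within_return)
      subgoal using that assms by (auto simp: recorded_at_most_def List.insert_def)
      subgoal using assms dims a b d by simp
      done
  qed
  have "runs_within (foldC ?point (grid x) out) (length (grid x) * (6 * c * n ^ 2))
      (recorded_at_most (b + length (grid x)))"
    by (rule runs_within_foldC[where I = recorded_at_most]) (rule point, assumption, rule assms(4))
  then show ?thesis by (simp only: sample_grid_def num_eq_length)
qed

text \<open>
  After \<open>k\<close> time steps the grid has been traversed \<open>k + 1\<close> times, once in the initialisation.
\<close>
definition loop_inv ::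
  "nat \<Rightarrow> real vec \<times> real vec \<times> real mat \<times> samples \<Rightarrow> bool" where
  "loop_inv k = (\<lambda>(lam, \<zeta>ref, N, out).
     dim_vec lam = n \<and> dim_row N = n \<and> dim_col N \<le> n \<and> recorded_at_most (G * Suc k) out)"

text \<open>
  Nine charges precede the grid pass. Bounding each by \<open>c (n^3 + m^3)\<close> gives the
  factor 9, and the factor 6 of the grid pass is rounded up to it.
\<close>
lemma time_step_within:
  assumes "loop_inv k s"
  shows "runs_within (time_step ks cm x s) (9 * c * step_work) (loop_inv (Suc k))"
proof -
  obtain lam \<zeta>ref N out where s [simp]: "s = (lam, \<zeta>ref, N, out)" using prod_cases4 by blast
  have inv: "dim_vec lam = n" "dim_row N = n" "dim_col N \<le> n" "recorded_at_most (G * Suc k) out"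
    using assms by (auto simp: loop_inv_def)
  let ?D = "n ^ 3 + m ^ 3"
  have "t_matvec cm n n \<le> c * ?D" "t_matvec cm m n \<le> c * ?D" "t_matvec cm n m \<le> c * ?D"
    using matvec_le[of n n] matvec_le[of m n] matvec_le[of n m] sizes powers
    by (auto intro: cost_mono simp: max.commute)
  moreover have "t_lp cm m \<le> c * ?D" "t_inv cm n \<le> c * ?D"
    using lp_le[of m] inv_le[of n] sizes by (auto intro: cost_mono)
  moreover have "n \<le> c * ?D"
    using powers by (auto intro: le_cost)
  moreover have "t_matmul cm n n (dim_col N) \<le> c * ?D" "t_orth cm n (dim_col N) \<le> c * ?D"
    using matmul_le[of n n "dim_col N"] orth_le[of n "dim_col N"] sizes inv
    by (auto intro: cost_mono simp: max_absorb1)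
  moreover have "9 * c * step_work = 9 * (c * ?D) + 9 * (G * (c * n ^ 2))"
    by (simp add: step_work_def algebra_simps)
  ultimately have cost: "t_matvec cm n n + (t_matvec cm m n + (t_lp cm m + (t_matvec cm n m + (n
      + (t_inv cm n + (t_matvec cm n n + (t_matmul cm n n (dim_col N) + (t_orth cm n (dim_col N)
      + (G * (6 * c * n ^ 2) + 0))))))))) \<le> 9 * c * step_work"
    by (simp add: algebra_simps)
  have N': "dim_row (orth ks (invert ks (matAd x) * N)) = n"
      "dim_col (orth ks (invert ks (matAd x) * N)) \<le> n"
    using dim_orth[of "invert ks (matAd x) * N"] by (simp_all add: dim_invert)
  have lam': "dim_vec (transpose_mat (matAd x) *\<^sub>v lam) = n"
    by (simp add: dims)
  show ?thesis
    unfolding time_step_def s prod.case matvecC_def argminC_def vsubC_def invC_def matmulC_def orthC_def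
    apply (rule runs_within_weaken)
     apply (rule runs_within_charge_bind)+
     apply (rule runs_within_bind)
      apply (rule sample_grid_within[OF N' lam' inv(4)])
     apply (rule runs_within_return)
    subgoal using N' lam' by (simp add: loop_inv_def add.commute)
    subgoal using cost by (simp add: dims inv dim_invert)
    done
qed

lemma admissible_within:
  assumes "recorded_at_most b (S, Bs)" and xc: "dim_vec xc = n"
  shows "runs_within (admissible cm Bs xc) (b * (3 * c * n)) (\<lambda>_. True)"
proof -
  have 1: "n \<le> c * n" "1 \<le> c * n" and 2: "t_dot cm n \<le> c * n"
    using sizes dot_le[of n] c_pos by (auto intro: le_cost)
  from 1 2 have cost: "n + (t_dot cm n + (1 + 0)) \<le> 3 * c * n" by linarith
  have "runs_within (admissible cm Bs xc) (length Bs * (3 * c * n)) (\<lambda>_. True)"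
    unfolding admissible_def
  proof (rule runs_within_foldC[where I = "\<lambda>_ _. True"])
    fix p ok assume "p \<in> set Bs"
    then obtain \<zeta> l where [simp]: "p = (\<zeta>, l)" and l: "dim_vec l = n"
      using assms by (cases p) (auto simp: recorded_at_most_def)
    show "runs_within ((case p of (\<zeta>, lz) \<Rightarrow> \<lambda>ok. do {
         d \<leftarrow> vsubC \<zeta> xc;
         p \<leftarrow> dotC cm lz d;
         nonneg \<leftarrow> leC 0 p;
         return (ok \<and> nonneg)
       }) ok) (3 * c * n) (\<lambda>_. True)"
      unfolding vsubC_def dotC_def leC_def \<open>p = _\<close> prod.case
      apply (rule runs_within_weaken)
       apply (rule runs_within_charge_bind)+
       apply (rule runs_within_return, simp)
      using cost by (simp add: xc l)
  qed simp
  moreover have "length Bs \<le> b" using assms by (simp add: recorded_at_most_def)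
  ultimately show ?thesis by (meson runs_within_weaken mult_le_mono1)
qed

text \<open>
  The factor 9 of the time steps dominates the other contributions: the initialisation incurs
  fewer charges than a time step, and the tests contribute a factor 3, doubled by
  \<open>K + 1 \<le> 2 K\<close>.
\<close>
lemma boundary_sampling_within:
  "runs_within (boundary_sampling ks cm x)
     (9 * c * (step_work + K * step_work + C * K * G * n)) (\<lambda>_. True)"
proof -
  let ?D = "n ^ 3 + m ^ 3"
  have "t_matvec cm n n \<le> c * ?D" "t_matvec cm m n \<le> c * ?D" 
    using matvec_le[of n n] matvec_le[of m n] sizes powers
    by (auto intro: cost_mono simp: max.commute)
  moreover have "t_lp cm m \<le> c * ?D" "t_dot cm m \<le> c * ?D" "t_solve cm 2 n \<le> c * ?D"
      "t_null cm 2 n \<le> c * ?D"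
    using lp_le[of m] dot_le[of m] solve_le[of 2 n] null_le[of 2 n] sizes powers
    by (auto intro: cost_mono simp: max_absorb2)
  moreover have "2 \<le> c * ?D"
    using powers by (auto intro: le_cost)
  moreover have "9 * c * step_work = 9 * (c * ?D) + 9 * (G * (c * n ^ 2))"
    by (simp add: step_work_def algebra_simps)
  ultimately have init: "t_matvec cm n n + t_matvec cm m n + t_lp cm m + t_dot cm m + 2
      + t_solve cm 2 n + t_null cm 2 n + G * (6 * c * n ^ 2) \<le> 9 * c * step_work"
    by (simp add: algebra_simps)
  \<comment> \<open>\<open>K + 1 \<le> 2 K\<close>, since there is at least one time step\<close>
  have "C * (G * Suc K * (3 * c * n)) \<le> C * (G * (2 * K) * (3 * c * n))"
    using sizes by (intro mult_le_mono) auto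
  also have "\<dots> \<le> 9 * c * (C * K * G * n)" by (simp add: algebra_simps)
  finally have tests: "C * (G * Suc K * (3 * c * n)) \<le> 9 * c * (C * K * G * n)" .
  have "9 * c * (step_work + K * step_work + C * K * G * n)
      = 9 * c * step_work + K * (9 * c * step_work) + 9 * c * (C * K * G * n)"
    by (simp add: algebra_simps)
  with init tests have total: "t_matvec cm n n + (t_matvec cm m n + (t_lp cm m + (t_dot cm m + (1 + (1
      + (t_solve cm 2 n + (t_null cm 2 n + (G * (6 * c * n ^ 2) + (K * (9 * c * step_work)
      + C * (G * Suc K * (3 * c * n))))))))))) \<le> 9 * c * (step_work + K * step_work + C * K * G * n)"
    by linarith
  have empty: "recorded_at_most 0 ({}, [])" by (simp add: recorded_at_most_def)
  have loop: "runs_within (foldC (\<lambda>_. time_step ks cm x) [1..<Suc (steps x)] s)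
      (K * (9 * c * step_work)) (loop_inv K)" if "loop_inv 0 s" for s
    using runs_within_foldC[where I = loop_inv and k = 0 and as = "[1..<Suc (steps x)]"
        and f = "\<lambda>_. time_step ks cm x", OF time_step_within that]
    by (simp add: num_eq_length del: upt_Suc)
  let ?test = "\<lambda>Bs xc S. do {
       ok \<leftarrow> admissible cm Bs xc;
       return (if ok then insert xc S else S)
     }"
  have cands: "runs_within (foldC (?test Bs) (cands x) S) (C * (G * Suc K * (3 * c * n))) (\<lambda>_. True)"
    if recorded: "recorded_at_most (G * Suc K) (S', Bs)" for S S' Bs
  proof -
    have test: "runs_within (?test Bs xc S) (G * Suc K * (3 * c * n)) (\<lambda>_. True)"
      if "xc \<in> set (cands x)" for xc S
    proof -
      have "runs_within (?test Bs xc S) (G * Suc K * (3 * c * n) + 0) (\<lambda>_. True)"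
        by (rule runs_within_bind[OF admissible_within[OF recorded cand_dim[OF that]]])
          (simp add: runs_within_return)
      then show ?thesis by simp
    qed
    have "runs_within (foldC (?test Bs) (cands x) S)
        (length (cands x) * (G * Suc K * (3 * c * n))) (\<lambda>_. True)"
      by (rule runs_within_foldC[where I = "\<lambda>_ _. True"]) (rule test, assumption, rule TrueI)
    then show ?thesis by (simp only: num_eq_length)
  qed
  have M: "dim_row (stackM n v w) = 2" "dim_col (stackM n v w) = n"
      "dim_row (null_basis ks (stackM n v w)) = n" "dim_col (null_basis ks (stackM n v w)) \<le> n" for v w
    using dim_null_basis[of "stackM n v w"] by (simp_all add: stackM_def)
  show ?thesis
    unfolding boundary_sampling_def matvecC_def argminC_def dotC_def negC_def solveC_def nullC_def Let_def
    apply (rule runs_within_weaken)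
     apply (rule runs_within_charge_bind)+
     apply (rule runs_within_bind)
      apply (rule sample_grid_within[OF M(3) M(4) dims(9) empty])
     apply (rule runs_within_bind)
      apply (rule loop)
      apply (simp add: loop_inv_def M dims)
     apply (clarsimp simp only: loop_inv_def prod.case split: prod.splits)
     apply (rule cands, assumption)
    subgoal using total by (simp only: dims M index_transpose_mat dim_mult_mat_vec)
    done
qed

lemma runtime_le: "runtime ks cm x \<le> real (9 * c) * (real n ^ 3 + real m ^ 3 + real G * real n ^ 2
    + real K * (real n ^ 3 + real m ^ 3 + real G * real n ^ 2) + real C * real K * real G * real n)"
proof -
  have "snd (run_state (boundary_sampling ks cm x) 0)
      \<le> 9 * c * (step_work + K * step_work + C * K * G * n)"
    using boundary_sampling_within unfolding runs_within_def by (metis add_0)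
  then have "runtime ks cm x \<le> real (9 * c * (step_work + K * step_work + C * K * G * n))"
    unfolding runtime_def of_nat_le_iff .
  then show ?thesis by (simp add: step_work_def)
qed

end

section \<open>Asymptotic bounds\<close>

lemma bigo_nonnegI:
  fixes f g :: "'a \<Rightarrow> real"
  assumes "\<forall>\<^sub>F x in F. 0 \<le> f x \<and> f x \<le> c * g x"
  shows "f \<in> O[F](g)"
proof (rule bigoI)
  have "norm a \<le> \<bar>c\<bar> * norm b" if "0 \<le> a \<and> a \<le> c * b" for a b :: real
    using that abs_ge_self[of "c * b"] by (simp add: abs_mult)
  with assms show "\<forall>\<^sub>F x in F. norm (f x) \<le> \<bar>c\<bar> * norm (g x)"
    by (auto elim: eventually_mono)
qed

theorem proposition9:
  fixes ks :: kernels and cm :: cost_model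
    and n m K G C :: "sampling_input \<Rightarrow> real" and T :: "sampling_input \<Rightarrow> real"
  defines "n \<equiv> \<lambda>x. real (dim_n x)" and "m \<equiv> \<lambda>x. real (dim_m x)"
    and "K \<equiv> \<lambda>x. real (num_K x)" and "G \<equiv> \<lambda>x. real (num_G x)" and "C \<equiv> \<lambda>x. real (num_C x)"
    and "T \<equiv> runtime ks cm"
  assumes "correct_kernels ks" and "dense_cost_model cm"
  shows
    "T \<in> O[principal {x. valid_input x}](\<lambda>x. n x ^ 3 + m x ^ 3 + G x * n x ^ 2
        + K x * (n x ^ 3 + m x ^ 3 + G x * n x ^ 2) + C x * K x * G x * n x)
     \<and> (\<forall>m0 K0 G0 C0. T \<in> O[principal {x. valid_input x
            \<and> m x = m0 \<and> K x = K0 \<and> G x = G0 \<and> C x = C0}](\<lambda>x. n x ^ 3))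
     \<and> (\<forall>n0 K0 G0 C0. T \<in> O[principal {x. valid_input x
            \<and> n x = n0 \<and> K x = K0 \<and> G x = G0 \<and> C x = C0}](\<lambda>x. m x ^ 3))
     \<and> (\<forall>n0 m0 G0 C0. T \<in> O[principal {x. valid_input x
            \<and> n x = n0 \<and> m x = m0 \<and> G x = G0 \<and> C x = C0}](\<lambda>x. K x))
     \<and> (\<forall>n0 m0 K0 C0. T \<in> O[principal {x. valid_input x
            \<and> n x = n0 \<and> m x = m0 \<and> K x = K0 \<and> C x = C0 \<and> 1 \<le> G x}](\<lambda>x. G x))
     \<and> (\<forall>C0. \<exists>c>0. \<forall>n0 m0. \<exists>G0. \<forall>x. valid_input x
            \<and> n x = n0 \<and> m x = m0 \<and> C x \<le> C0 \<and> G0 \<le> G x \<longrightarrow> T x \<le> c * (K x * G x * n x ^ 2))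
     \<and> (\<forall>F. F \<le> principal {x. valid_input x}
            \<and> C \<in> o[F](G) \<and> n \<in> o[F](G) \<and> m \<in> o[F](G)
            \<and> C \<in> O[F](n) \<and> (\<lambda>x. m x ^ 3) \<in> O[F](\<lambda>x. G x * n x ^ 2)
            \<longrightarrow> T \<in> O[F](\<lambda>x. K x * G x * n x ^ 2))"
proof -
  obtain c where "dense_costs cm c"
    using dense_cost_model_imp_dense_costs[OF \<open>dense_cost_model cm\<close>] ..
  then have run: "sampling_run cm c ks x" if "valid_input x" for x
    using that \<open>correct_kernels ks\<close> by (simp add: sampling_run_def sampling_run_axioms_def)
  define b where "b = real (9 * c)"
  have b0: "0 \<le> b" by (simp add: b_def)
  have T0: "0 \<le> T x" for x by (simp add: T_def runtime_def)
  have pos: "1 \<le> n x" "1 \<le> m x" "1 \<le> K x" if "valid_input x" for x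
    using sampling_run.sizes[OF run[OF that]] by (simp_all add: n_def m_def K_def)
  have nonneg: "0 \<le> n x" "0 \<le> m x" "0 \<le> K x" "0 \<le> G x" "0 \<le> C x" for x
    by (simp_all add: n_def m_def K_def G_def C_def)
  have T_le: "T x \<le> b * (n x ^ 3 + m x ^ 3 + G x * n x ^ 2
      + K x * (n x ^ 3 + m x ^ 3 + G x * n x ^ 2) + C x * K x * G x * n x)" if "valid_input x" for x
    using sampling_run.runtime_le[OF run[OF that]]
    by (simp add: T_def n_def m_def K_def G_def C_def b_def)
  \<comment> \<open>The runtime depends on the sizes only through the work per step and the work of all tests,
    and monotonically so; every estimate below bounds these two separately.\<close>
  have T_le_via: "T x \<le> b * ((1 + K x) * p + q)"
    if "valid_input x" "n x ^ 3 + m x ^ 3 + G x * n x ^ 2 \<le> p" "C x * K x * G x * n x \<le> q" for x p q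
  proof -
    have "T x \<le> b * ((1 + K x) * (n x ^ 3 + m x ^ 3 + G x * n x ^ 2) + C x * K x * G x * n x)"
      using T_le[OF that(1)] by (simp add: algebra_simps)
    also have "\<dots> \<le> b * ((1 + K x) * p + q)"
      using that b0 nonneg by (intro mult_left_mono add_mono) auto
    finally show ?thesis .
  qed
  \<comment> \<open>The common core of the two simplified bounds: the grid dominates the cubic terms and the
    state dimension dominates the number of candidates.\<close>
  have T_le_dominated: "T x \<le> b * (2 * p + q) * (K x * G x * n x ^ 2)"
    if "valid_input x" "n x ^ 3 + m x ^ 3 + G x * n x ^ 2 \<le> p * (G x * n x ^ 2)" "C x \<le> q * n x" 
      "0 \<le> p" for x p q
  proof -
    have "C x * K x * G x * n x = C x * (K x * G x * n x)" by simp
    also have "\<dots> \<le> q * n x * (K x * G x * n x)"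
      using that nonneg by (intro mult_right_mono) auto
    finally have "T x \<le> b * ((1 + K x) * (p * (G x * n x ^ 2)) + q * n x * (K x * G x * n x))"
      using that by (intro T_le_via) auto
    also have "\<dots> \<le> b * (2 * K x * (p * (G x * n x ^ 2)) + q * n x * (K x * G x * n x))"
      using that pos[of x] b0 nonneg by (intro mult_left_mono add_mono mult_right_mono) auto
    finally show ?thesis by (simp add: algebra_simps power2_eq_square)
  qed

  show ?thesis
  proof (intro conjI allI impI)
    show "T \<in> O[principal {x. valid_input x}](\<lambda>x. n x ^ 3 + m x ^ 3 + G x * n x ^ 2
        + K x * (n x ^ 3 + m x ^ 3 + G x * n x ^ 2) + C x * K x * G x * n x)"
      by (rule bigo_nonnegI[where c = b]) (use T0 T_le in \<open>auto simp: eventually_principal\<close>)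
  next
    fix m0 K0 G0 C0
    have "T x \<le> b * ((1 + K x) * (1 + m x ^ 3 + G x) + C x * K x * G x) * n x ^ 3"
      if "valid_input x" for x
    proof -
      have n: "1 \<le> n x ^ 3" "n x ^ 2 \<le> n x ^ 3" "n x \<le> n x ^ 3"
        using pos[OF that] power_increasing[of 1 3 "n x"] power_increasing[of 2 3 "n x"]
        by (auto simp: one_le_power)
      have "T x \<le> b * ((1 + K x) * ((1 + m x ^ 3 + G x) * n x ^ 3) + C x * K x * G x * n x ^ 3)"
        using mult_left_mono[OF n(1), of "m x ^ 3"] mult_left_mono[OF n(2), of "G x"]
          mult_left_mono[OF n(3), of "C x * K x * G x"] nonneg[of x] that
        by (intro T_le_via) (auto simp: algebra_simps)
      then show ?thesis by (simp add: algebra_simps)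
    qed
    then show "T \<in> O[principal {x. valid_input x
        \<and> m x = m0 \<and> K x = K0 \<and> G x = G0 \<and> C x = C0}](\<lambda>x. n x ^ 3)"
      using T0 by (intro bigo_nonnegI[where c = "b * ((1 + K0) * (1 + m0 ^ 3 + G0) + C0 * K0 * G0)"])
        (auto simp: eventually_principal)
  next
    fix n0 K0 G0 C0
    have "T x \<le> b * ((1 + K x) * (n x ^ 3 + 1 + G x * n x ^ 2) + C x * K x * G x * n x) * m x ^ 3"
      if "valid_input x" for x
    proof -
      have m: "1 \<le> m x ^ 3"
        using pos[OF that] by (auto simp: one_le_power)
      have "T x \<le> b * ((1 + K x) * ((n x ^ 3 + 1 + G x * n x ^ 2) * m x ^ 3)
          + C x * K x * G x * n x * m x ^ 3)"
        using mult_left_mono[OF m, of "n x ^ 3"] mult_left_mono[OF m, of "G x * n x ^ 2"]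
          mult_left_mono[OF m, of "C x * K x * G x * n x"] nonneg[of x] that
        by (intro T_le_via) (auto simp: algebra_simps)
      then show ?thesis by (simp add: algebra_simps)
    qed
    then show "T \<in> O[principal {x. valid_input x
        \<and> n x = n0 \<and> K x = K0 \<and> G x = G0 \<and> C x = C0}](\<lambda>x. m x ^ 3)"
      using T0 by (intro bigo_nonnegI[where
            c = "b * ((1 + K0) * (n0 ^ 3 + 1 + G0 * n0 ^ 2) + C0 * K0 * G0 * n0)"])
        (auto simp: eventually_principal)
  next
    fix n0 m0 G0 C0
    have "T x \<le> b * (2 * (n x ^ 3 + m x ^ 3 + G x * n x ^ 2) + C x * G x * n x) * K x"
      if "valid_input x" for x
    proof -
      have "T x \<le> b * ((1 + K x) * (n x ^ 3 + m x ^ 3 + G x * n x ^ 2) + C x * K x * G x * n x)"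
        using that by (rule T_le_via) simp_all
      also have "\<dots> \<le> b * (2 * K x * (n x ^ 3 + m x ^ 3 + G x * n x ^ 2) + C x * K x * G x * n x)"
        using pos[OF that] b0 nonneg by (intro mult_left_mono add_mono mult_right_mono) auto
      finally show ?thesis by (simp add: algebra_simps)
    qed
    then show "T \<in> O[principal {x. valid_input x
        \<and> n x = n0 \<and> m x = m0 \<and> G x = G0 \<and> C x = C0}](\<lambda>x. K x)"
      using T0 by (intro bigo_nonnegI[where
            c = "b * (2 * (n0 ^ 3 + m0 ^ 3 + G0 * n0 ^ 2) + C0 * G0 * n0)"])
        (auto simp: eventually_principal)
  next
    fix n0 m0 K0 C0
    have "T x \<le> b * ((1 + K x) * (n x ^ 3 + m x ^ 3 + n x ^ 2) + C x * K x * n x) * G x"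
      if "valid_input x" "1 \<le> G x" for x
    proof -
      have "T x \<le> b * ((1 + K x) * ((n x ^ 3 + m x ^ 3 + n x ^ 2) * G x) + C x * K x * G x * n x)"
        using mult_left_mono[OF that(2), of "n x ^ 3"] mult_left_mono[OF that(2), of "m x ^ 3"]
          nonneg[of x] that by (intro T_le_via) (auto simp: algebra_simps)
      then show ?thesis by (simp add: algebra_simps)
    qed
    then show "T \<in> O[principal {x. valid_input x
        \<and> n x = n0 \<and> m x = m0 \<and> K x = K0 \<and> C x = C0 \<and> 1 \<le> G x}](\<lambda>x. G x)"
      using T0 by (intro bigo_nonnegI[where
            c = "b * ((1 + K0) * (n0 ^ 3 + m0 ^ 3 + n0 ^ 2) + C0 * K0 * n0)"])
        (auto simp: eventually_principal)
  next
    fix C0 :: real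
    define c' where "c' = b * (4 + \<bar>C0\<bar>) + 1"
    have "0 < c'" using b0 by (simp add: c'_def add_nonneg_pos)
    moreover have "T x \<le> c' * (K x * G x * n x ^ 2)"
      if x: "valid_input x" "n x = n0" "m x = m0" "C x \<le> C0" "n0 ^ 3 + m0 ^ 3 \<le> G x" for n0 m0 x
    proof -
      have n: "1 \<le> n x ^ 2"
        using pos[OF x(1)] by (simp add: one_le_power)
      have "G x \<le> G x * n x ^ 2"
        using mult_left_mono[OF n nonneg(4)] by simp
      moreover have "C x \<le> \<bar>C0\<bar> * n x"
        using x(4) mult_left_mono[OF pos(1)[OF x(1)], of "\<bar>C0\<bar>"] by linarith
      ultimately have "T x \<le> b * (2 * 2 + \<bar>C0\<bar>) * (K x * G x * n x ^ 2)"
        using x by (intro T_le_dominated) auto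
      also have "\<dots> \<le> c' * (K x * G x * n x ^ 2)"
        using nonneg[of x] by (intro mult_right_mono) (auto simp: c'_def)
      finally show ?thesis .
    qed
    \<comment> \<open>The threshold for the number of grid points is \<open>n0 ^ 3 + m0 ^ 3\<close>.\<close>
    ultimately show "\<exists>c>0. \<forall>n0 m0. \<exists>G0. \<forall>x. valid_input x
        \<and> n x = n0 \<and> m x = m0 \<and> C x \<le> C0 \<and> G0 \<le> G x \<longrightarrow> T x \<le> c * (K x * G x * n x ^ 2)"
      by blast
  next
    fix F
    assume asm: "F \<le> principal {x. valid_input x} \<and> C \<in> o[F](G) \<and> n \<in> o[F](G) \<and> m \<in> o[F](G)
      \<and> C \<in> O[F](n) \<and> (\<lambda>x. m x ^ 3) \<in> O[F](\<lambda>x. G x * n x ^ 2)"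
    have valid: "\<forall>\<^sub>F x in F. valid_input x"
      using asm by (auto simp: le_principal)
    have n: "\<forall>\<^sub>F x in F. n x \<le> G x"
      using asm landau_o.smallD[of n F G 1] nonneg by simp
    obtain p where "0 < p" and m: "\<forall>\<^sub>F x in F. m x ^ 3 \<le> p * (G x * n x ^ 2)"
      using asm landau_o.bigE[of "\<lambda>x. m x ^ 3" F "\<lambda>x. G x * n x ^ 2"] nonneg by auto
    obtain q where C: "\<forall>\<^sub>F x in F. norm (C x) \<le> q * norm (n x)"
      using asm landau_o.bigE by blast
    from valid n m C have "\<forall>\<^sub>F x in F. T x \<le> b * (2 * (2 + p) + q) * (K x * G x * n x ^ 2)"
    proof eventually_elim
      case (elim x)
      have "n x ^ 3 = n x * n x ^ 2" by (simp add: power2_eq_square power3_eq_cube)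
      also have "\<dots> \<le> G x * n x ^ 2"
        using elim by (intro mult_right_mono) auto
      finally have "n x ^ 3 \<le> G x * n x ^ 2" .
      moreover have "C x \<le> q * n x"
        using elim nonneg[of x] by simp
      ultimately show ?case
        using elim \<open>0 < p\<close> by (intro T_le_dominated) (auto simp: algebra_simps)
    qed
    then show "T \<in> O[F](\<lambda>x. K x * G x * n x ^ 2)"
      using T0 by (intro bigo_nonnegI) (auto elim: eventually_mono)
  qed
qed

end
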